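(* Let $A$ be a nonempty finite subset of a field $\mathbb{F}$ with $|A| = k$ and $A \cap (- A) = \varnothing$. Then $$|2_{\pm}A| \geq \begin{cases} 4k - 2, & \text{if } p(\mathbb{F}) \geq 4k - 1; \\ p(\mathbb{F}) - 1, & \text{otherwise}. \end{cases}$$
   Context: For a field $\mathbb{F}$, $p(\mathbb{F})$ denotes the order of the smallest nontrivial subgroup of the additive group of $\mathbb{F}$, or $\infty$ if there is no such finite subgroup; equivalently, the characteristic of $\mathbb{F}$ if it is positive and $\infty$ if the characteristic is $0$. For a finite set $A=\{a_1,\dots,a_k\}$ with $|A|=k$, write $-A=\{-a:a\in A\}$ and $2_{\pm}A=\{\sum_{i=1}^k\lambda_i a_i:\lambda_i\in\mathbb{Z}\cap[-2,2],\ \sum_{i=1}^k|\lambda_i|=2\}$. *)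

theory Defs
  imports Complex_Main "HOL-Library.Extended_Nat"
begin

definition is_add_subgroup :: "'a::group_add set \<Rightarrow> bool" where
  "is_add_subgroup H \<longleftrightarrow>
     0 \<in> H \<and> (\<forall>x\<in>H. \<forall>y\<in>H. x + y \<in> H) \<and> (\<forall>x\<in>H. - x \<in> H)"

(* The infimum is taken in enat, so it is \<infinity> when there is no finite nontrivial
   additive subgroup, and otherwise it is attained. The argument only carries the type. *)
definition min_subgroup_order :: "'a::group_add itself \<Rightarrow> enat" where
  "min_subgroup_order _ =
     (INF H \<in> {H :: 'a set. is_add_subgroup H \<and> H \<noteq> {0} \<and> finite H}. enat (card H))"

(* The set called 2_{+-}A in the literature. The coefficients are indexed by the elements
   of A themselves; the values of l outside A are irrelevant. *)
definition two_pm :: "'a::ring_1 set \<Rightarrow> 'a set" where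
  "two_pm A =
     {\<Sum>a\<in>A. of_int (l a) * a | l :: 'a \<Rightarrow> int.
        (\<forall>a\<in>A. l a \<in> {-2..2}) \<and> (\<Sum>a\<in>A. \<bar>l a\<bar>) = 2}"

end

theory Submission imports Defs "HOL-Library.Set_Algebras" "HOL-Library.FuncSet" begin

text \<open>
  The set \<open>B = A \<union> -A\<close> turns the signed problem into an ordinary sumset problem. Since
  \<open>A\<close> and \<open>-A\<close> are disjoint, \<open>B\<close> has \<open>2k\<close> elements. Every nonzero sum of two elements of
  \<open>B\<close> lies in \<open>2\<^sub>\<plusminus>A\<close>: the only sums whose coefficients fail to have total absolute value 2
  are the cancelling ones \<open>a + (-a)\<close>. Hence \<open>2\<^sub>\<plusminus>A\<close> has at least \<open>|B + B| - 1\<close> elements, and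
  the Cauchy--Davenport inequality \<open>|B + B| \<ge> min (p, 4k - 1)\<close> gives both cases at once.

  The Cauchy--Davenport inequality holds in every abelian group when \<open>p\<close> is the least order of a
  nontrivial finite subgroup. It is proved by induction on the second summand with
  Dyson's e-transform, which replaces \<open>X, Y\<close> by \<open>X \<union> (Y + e), Y \<inter> (X - e)\<close>: this preserves the
  total size and does not enlarge the sumset. The transform shrinks \<open>Y\<close> unless
  \<open>Y + e \<subseteq> X\<close>. If that happens for every difference \<open>e = x - y\<close>, then \<open>X\<close> is invariant under
  translation by a nonzero difference of elements of \<open>Y\<close>, so \<open>X\<close> contains a coset of the
  nontrivial finite subgroup of its periods and already has at least \<open>p\<close> elements.
\<close>

section \<open>The Cauchy--Davenport inequality in abelian groups\<close>

text \<open>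
  The periods of \<open>X\<close> form a subgroup, and translating it by any point of \<open>X\<close> embeds it into \<open>X\<close>.
  This settles the case in which the e-transform makes no progress.
\<close>
lemma card_period_ge_min_subgroup_order:
  fixes X :: "'a::ab_group_add set"
  assumes "finite X" "X \<noteq> {}" and "d \<noteq> 0" and period: "(+) d ` X \<subseteq> X"
  shows "min_subgroup_order TYPE('a) \<le> enat (card X)"
proof -
  \<comment> \<open>Since \<open>X\<close> is finite, demanding inclusion is the same as demanding equality; equality makes
    closure under negation immediate.\<close>
  define H where "H = {h. (+) h ` X = X}"
  have "d \<in> H"
    unfolding H_def using period \<open>finite X\<close> by (simp add: endo_inj_surj)
  have "x + y \<in> H" if "x \<in> H" "y \<in> H" for x y
  proof -
    have "(+) (x + y) ` X = (+) x ` ((+) y ` X)"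
      by (simp add: image_image add.assoc)
    with that show ?thesis by (simp add: H_def)
  qed
  moreover have "- x \<in> H" if "x \<in> H" for x
  proof -
    have "(+) (- x) ` X = (+) (- x) ` ((+) x ` X)"
      using that by (simp add: H_def)
    then show ?thesis by (simp add: H_def image_image)
  qed
  ultimately have subgroup: "is_add_subgroup H"
    by (simp add: is_add_subgroup_def H_def)
  obtain x where "x \<in> X" using \<open>X \<noteq> {}\<close> by blast
  have "(\<lambda>h. h + x) ` H \<subseteq> X"
    using \<open>x \<in> X\<close> by (auto simp: H_def)
  moreover have "inj_on (\<lambda>h. h + x) H" by (simp add: inj_on_def)
  ultimately have "finite H" "card H \<le> card X"
    using \<open>finite X\<close> by (meson inj_on_finite, meson card_inj_on_le)
  have "min_subgroup_order TYPE('a) \<le> enat (card H)"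
    unfolding min_subgroup_order_def
    using subgroup \<open>finite H\<close> \<open>d \<in> H\<close> \<open>d \<noteq> 0\<close> by (intro INF_lower) auto
  with \<open>card H \<le> card X\<close> show ?thesis
    by (meson enat_ord_simps(1) order_trans)
qed

theorem Cauchy_Davenport:
  fixes X Y :: "'a::ab_group_add set"
  assumes "finite X" "X \<noteq> {}" "finite Y" "Y \<noteq> {}"
  shows "min (min_subgroup_order TYPE('a)) (enat (card X + card Y - 1)) \<le> enat (card (X + Y))"
  using assms
proof (induction "card Y" arbitrary: X Y rule: less_induct)
  case less
  have finite_sum: "finite (X + Y)"
    using less.prems by (simp add: finite_set_plus)
  obtain y where "y \<in> Y" using less.prems by blast
  have card_le: "card X \<le> card (X + Y)"
  proof (rule card_inj_on_le)
    show "(\<lambda>x. x + y) ` X \<subseteq> X + Y" using \<open>y \<in> Y\<close> by auto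
  qed (use finite_sum in \<open>auto simp: inj_on_def\<close>)
  consider (singleton) "Y = {y}"
    | (periodic) "Y \<noteq> {y}" "\<forall>x\<in>X. \<forall>y\<in>Y. (+) (x - y) ` Y \<subseteq> X"
    | (transform) x z where "x \<in> X" "z \<in> Y" "\<not> (+) (x - z) ` Y \<subseteq> X"
    by blast
  then show ?case
  proof cases
    case singleton
    with card_le show ?thesis
      by (simp add: min.coboundedI2)
  next
    case periodic
    then obtain z where "z \<in> Y" "z \<noteq> y" using \<open>y \<in> Y\<close> by blast
    have "(+) (z - y) ` X \<subseteq> X"
    proof
      fix w assume "w \<in> (+) (z - y) ` X"
      then obtain x where "x \<in> X" "w = (x - y) + z" by auto
      with periodic \<open>y \<in> Y\<close> \<open>z \<in> Y\<close> show "w \<in> X" by blast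
    qed
    then have "min_subgroup_order TYPE('a) \<le> enat (card X)"
      using less.prems \<open>z \<noteq> y\<close>
      by (intro card_period_ge_min_subgroup_order[of _ "z - y"]) auto
    with card_le show ?thesis
      by (meson enat_ord_simps(1) min.coboundedI1 order_trans)
  next
    case transform
    define e where "e = x - z"
    define X' where "X' = X \<union> (+) e ` Y"
    define Y' where "Y' = {v \<in> Y. e + v \<in> X}"
    have "z \<in> Y'" using transform by (simp add: Y'_def e_def)
    have "finite X'" "X' \<noteq> {}" "finite Y'"
      using less.prems by (auto simp: X'_def Y'_def)
    have "Y' \<subset> Y" using transform by (auto simp: Y'_def e_def)
    then have "card Y' < card Y" using less.prems by (simp add: psubset_card_mono)
    then have IH: "min (min_subgroup_order TYPE('a)) (enat (card X' + card Y' - 1))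
        \<le> enat (card (X' + Y'))"
      using less.hyps \<open>finite X'\<close> \<open>X' \<noteq> {}\<close> \<open>finite Y'\<close> \<open>z \<in> Y'\<close> by blast
    have "X' + Y' \<subseteq> X + Y"
    proof
      fix w assume "w \<in> X' + Y'"
      then obtain u v where w: "w = u + v" "u \<in> X'" "v \<in> Y'" by (auto elim: set_plus_elim)
      show "w \<in> X + Y"
      proof (cases "u \<in> X")
        case True
        with w show ?thesis by (auto simp: Y'_def)
      next
        case False
        \<comment> \<open>The shift by \<open>e\<close> moves from one summand to the other.\<close>
        with w obtain t where "t \<in> Y" "w = (e + v) + t"
          by (auto simp: X'_def algebra_simps)
        with w show ?thesis by (auto simp: Y'_def)
      qed
    qed
    then have "card (X' + Y') \<le> card (X + Y)"
      using finite_sum by (simp add: card_mono)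
    moreover have "card X' + card Y' = card X + card Y"
    proof -
      have "X \<inter> (+) e ` Y = (+) e ` Y'" by (auto simp: Y'_def)
      then have "card (X \<inter> (+) e ` Y) = card Y'"
        by (simp add: card_image)
      moreover have "card X + card ((+) e ` Y) = card X' + card (X \<inter> (+) e ` Y)"
        unfolding X'_def using less.prems by (intro card_Un_Int) auto
      ultimately show ?thesis by (simp add: card_image)
    qed
    ultimately show ?thesis
      using IH by (metis enat_ord_simps(1) order_trans)
  qed
qed

section \<open>Signed sums and the symmetric set\<close>

lemma finite_two_pm:
  assumes "finite A"
  shows "finite (two_pm A)"
proof (rule finite_subset)
  show "two_pm A \<subseteq> (\<lambda>l. \<Sum>a\<in>A. of_int (l a) * a) ` (A \<rightarrow>\<^sub>E {-2..2})"
  proof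
    fix x assume "x \<in> two_pm A"
    then obtain l where l: "x = (\<Sum>a\<in>A. of_int (l a) * a)" "\<forall>a\<in>A. l a \<in> {-2..2}"
      unfolding two_pm_def by blast
    then have "x = (\<Sum>a\<in>A. of_int (restrict l A a) * a)" "restrict l A \<in> A \<rightarrow>\<^sub>E {-2..2}"
      by auto
    then show "x \<in> (\<lambda>l. \<Sum>a\<in>A. of_int (l a) * a) ` (A \<rightarrow>\<^sub>E {-2..2})" by blast
  qed
  show "finite ((\<lambda>l. \<Sum>a\<in>A. of_int (l a) * a) ` (A \<rightarrow>\<^sub>E {-2..2::int}))"
    using assms by (intro finite_imageI finite_PiE) auto
qed

text \<open>
  The coefficient function puts weight \<open>s\<close> at \<open>a\<close> and weight \<open>t\<close> at \<open>b\<close>, adding the weights if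
  \<open>a = b\<close>. Excluding cancellation makes absolute values additive, so the total is \<open>2\<close>.
\<close>
lemma signed_pair_in_two_pm:
  fixes s t :: int
  assumes "finite A" "a \<in> A" "b \<in> A" and sign: "\<bar>s\<bar> = 1" "\<bar>t\<bar> = 1"
    and no_cancel: "a = b \<Longrightarrow> s = t"
  shows "of_int s * a + of_int t * b \<in> two_pm A"
proof -
  define l where "l c = (if c = a then s else 0) + (if c = b then t else 0)" for c
  have abs_l: "\<bar>l c\<bar> = (if c = a then 1 else 0) + (if c = b then 1 else 0)" for c
    using sign no_cancel by (auto simp: l_def)
  have "(\<Sum>c\<in>A. of_int (l c) * c)
      = (\<Sum>c\<in>A. (if c = a then of_int s * a else 0) + (if c = b then of_int t * b else 0))"
    by (intro sum.cong) (auto simp: l_def algebra_simps)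
  also have "\<dots> = of_int s * a + of_int t * b"
    using assms by (simp add: sum.distrib)
  finally have "of_int s * a + of_int t * b = (\<Sum>c\<in>A. of_int (l c) * c)" ..
  moreover have "(\<Sum>c\<in>A. \<bar>l c\<bar>) = 2"
    using assms by (simp add: abs_l sum.distrib)
  moreover have "l c \<in> {-2..2}" for c
    using abs_l[of c] by (auto split: if_splits)
  ultimately show ?thesis unfolding two_pm_def by blast
qed

lemma nonzero_sums_subset_two_pm:
  fixes A :: "'a::ring_1 set"
  assumes "finite A"
  shows "(A \<union> uminus ` A) + (A \<union> uminus ` A) - {0} \<subseteq> two_pm A"
proof
  have signed: "\<exists>s a. x = of_int s * a \<and> a \<in> A \<and> \<bar>s\<bar> = 1" if "x \<in> A \<union> uminus ` A" for x
  proof (cases "x \<in> A")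
    case True
    then have "x = of_int 1 * x \<and> x \<in> A \<and> \<bar>1 :: int\<bar> = 1" by simp
    then show ?thesis by blast
  next
    case False
    with that obtain a where "x = - a" "a \<in> A" by blast
    then have "x = of_int (- 1) * a \<and> a \<in> A \<and> \<bar>- 1 :: int\<bar> = 1" by simp
    then show ?thesis by blast
  qed
  fix w assume w: "w \<in> (A \<union> uminus ` A) + (A \<union> uminus ` A) - {0}"
  then obtain x y where xy: "w = x + y" "x \<in> A \<union> uminus ` A" "y \<in> A \<union> uminus ` A"
    by (auto elim!: set_plus_elim)
  obtain s a t b where ab: "x = of_int s * a" "a \<in> A" "\<bar>s\<bar> = 1"
      "y = of_int t * b" "b \<in> A" "\<bar>t\<bar> = 1"
    using signed xy by meson
  have "s = t" if "a = b"
  proof (rule ccontr)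
    assume "s \<noteq> t"
    with ab have "s = - t" by linarith
    with that ab xy have "w = 0" by simp
    with w show False by simp
  qed
  then show "w \<in> two_pm A"
    using signed_pair_in_two_pm[OF assms ab(2,5,3,6)] xy ab by simp
qed

section \<open>The lower bound for signed sums\<close>

theorem theorem3p6:
  fixes A :: "'a::field set" and k :: nat
  assumes "finite A" and "A \<noteq> {}" and "card A = k"
    and "A \<inter> uminus ` A = {}"
  shows "enat (card (two_pm A)) \<ge>
    (if min_subgroup_order TYPE('a) \<ge> enat (4 * k - 1)
     then enat (4 * k - 2)
     else min_subgroup_order TYPE('a) - 1)"
proof -
  define B where "B = A \<union> uminus ` A"
  have "finite B" "B \<noteq> {}" using assms by (auto simp: B_def)
  have "card B = 2 * k"
    using assms by (simp add: B_def card_Un_disjoint card_image)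
  then have CD: "min (min_subgroup_order TYPE('a)) (enat (4 * k - 1)) \<le> enat (card (B + B))"
    using Cauchy_Davenport[OF \<open>finite B\<close> \<open>B \<noteq> {}\<close> \<open>finite B\<close> \<open>B \<noteq> {}\<close>] by simp
  have "card (B + B) - 1 \<le> card (B + B - {0})"
    by (simp add: card_Diff_singleton_if)
  also have "\<dots> \<le> card (two_pm A)"
    using finite_two_pm nonzero_sums_subset_two_pm assms(1)
    unfolding B_def by (intro card_mono)
  finally have card_ge: "card (B + B) - 1 \<le> card (two_pm A)" .
  show ?thesis
  proof (cases "min_subgroup_order TYPE('a) \<ge> enat (4 * k - 1)")
    case True
    with CD have "4 * k - 1 \<le> card (B + B)" by (simp add: min_absorb2)
    with True card_ge show ?thesis by simp
  next
    case False
    then obtain p where p: "min_subgroup_order TYPE('a) = enat p" "p < 4 * k - 1"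
      by (cases "min_subgroup_order TYPE('a)") auto
    with CD have "p \<le> card (B + B)" by simp
    with p card_ge show ?thesis by (simp add: one_enat_def)
  qed
qed

end
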